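(* Let $\mathcal R_{\mathcal X}$ be the distinguished restriction of a planar vector field $\mathcal X$ with nilpotent linearization at the origin, and suppose that near $u=0$ $$\mathcal R_{\mathcal X}(u)=Cu^2\,\frac{a+bu}{d-eu},\qquad Cd\neq0,$$ with real constants $C,a,b,d,e$. Write $\mathcal R_{\mathcal X}(u)=\sum_{k\ge2}g_ku^k$. Then the following statements are equivalent: 1. $\Sigma:=ae+bd=0$; 2. $g_k=0$ for every $k\ge3$; 3. the distinguished restriction is exactly quadratic, $\mathcal R_{\mathcal X}(u)=\dfrac{Ca}{d}u^2$.
   Context: Setting: $\mathcal X$ is a $C^r$ ($r\ge2$) vector field near the origin of $\mathbb R^2$, $\mathcal X(0)=0$, and $A=D\mathcal X(0)$ satisfies $A\ne0$, $A^2=0$, so $\ker A=\operatorname{im}A$ is one-dimensional. For a generator $\mathbf q\neq0$ of $\ker A$, the distinguished restriction is the unique scalar function near $0$ with $A\mathcal X(u\mathbf q)=\mathcal R_{\mathcal X}(u)\mathbf q$. Here $e$ is a real parameter, not Euler's number. *)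

theory Defs
  imports "HOL-Analysis.Analysis"
begin

text \<open>
  \<open>C_class_on k f S\<close> is only meant for open \<open>S\<close>. For functions on a Euclidean space it is then
  the usual \<open>C^k\<close>: all iterated directional derivatives of order at most \<open>k\<close> exist and are continuous.
\<close>
primrec C_class_on ::
  "nat \<Rightarrow> ('a::real_normed_vector \<Rightarrow> 'b::real_normed_vector) \<Rightarrow> 'a set \<Rightarrow> bool" where
  "C_class_on 0 f S \<longleftrightarrow> continuous_on S f"
| "C_class_on (Suc k) f S \<longleftrightarrow>
     (\<forall>x\<in>S. f differentiable (at x)) \<and>
     (\<forall>v. C_class_on k (\<lambda>x. frechet_derivative f (at x) v) S)"

text \<open>
  The description determines a value only where \<open>A X(u q)\<close> lies on the line spanned by \<open>q\<close>. If the
  linearization \<open>A\<close> of \<open>X\<close> at \<open>0\<close> satisfies \<open>A\<^sup>2 = 0\<close> and \<open>q\<close> generates its kernel, this is the case for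
  every \<open>u\<close>, see below. Vector fields are total functions here, so the values for \<open>u q\<close> outside
  the neighbourhood of interest are meaningless, and only the germ at \<open>0\<close> matters.
\<close>
definition distinguished_restriction ::
  "(real^2 \<Rightarrow> real^2) \<Rightarrow> real^2 \<Rightarrow> real \<Rightarrow> real" where
  "distinguished_restriction X q u =
     (THE s. jacobian X (at 0) *v X (u *\<^sub>R q) = s *\<^sub>R q)"

lemma distinguished_restriction:
  assumes "jacobian X (at 0) ** jacobian X (at 0) = 0"
    and "q \<noteq> 0" and "{v. jacobian X (at 0) *v v = 0} = span {q}"
  shows "jacobian X (at 0) *v X (u *\<^sub>R q) = distinguished_restriction X q u *\<^sub>R q"
proof -
  let ?A = "jacobian X (at 0)"
  have "?A *v (?A *v X (u *\<^sub>R q)) = 0"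
    using assms(1) by (simp add: matrix_vector_mul_assoc)
  then have "?A *v X (u *\<^sub>R q) \<in> span {q}"
    using assms(3) by blast
  then obtain s where "?A *v X (u *\<^sub>R q) = s *\<^sub>R q"
    by (auto simp: span_singleton)
  then have "\<exists>!s. ?A *v X (u *\<^sub>R q) = s *\<^sub>R q"
    using assms(2) by auto
  then show ?thesis
    unfolding distinguished_restriction_def by (rule theI')
qed

definition power_series_from_2 :: "(nat \<Rightarrow> real) \<Rightarrow> (real \<Rightarrow> real) \<Rightarrow> bool" where
  "power_series_from_2 g R \<longleftrightarrow>
     (\<forall>\<^sub>F u in nhds 0. (\<lambda>k. g (k + 2) * u ^ (k + 2)) sums R u)"

end

theory Submission
  imports Defs
begin

text \<open>
  Since \<open>(a + b u) d - a (d - e u) = (a e + b d) u = \<Sigma> u\<close>, splitting off the value at \<open>0\<close> gives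
  \<open>(a + b u) / (d - e u) = a / d + (\<Sigma> / d) u / (d - e u)\<close>, and the last quotient is a geometric
  series in \<open>(e / d) u\<close>. So \<open>R\<close> has the power series with quadratic coefficient \<open>C a / d\<close> and
  higher coefficients \<open>g (k + 3) = C \<Sigma> / d\<^sup>2 (e / d) ^ k\<close>
  (\<open>power_series_from_2_rational\<close>). The coefficients of a power series are determined
  by the germ of its sum (\<open>power_series_from_2_unique\<close>), so every expansion of \<open>R\<close> is this one.

  All higher coefficients carry the factor \<open>\<Sigma>\<close>, and the cubic one is a nonzero multiple of it:
  they vanish together exactly when \<open>\<Sigma> = 0\<close>. That this means that \<open>R\<close> is its own quadratic
  term is again uniqueness, applied to the one-term series (\<open>higher_coeffs_zero_iff\<close>).
\<close>

lemma fps_nth_eq_higher_deriv: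
  fixes f :: "real \<Rightarrow> real"
  assumes "f has_fps_expansion F"
  shows "fps_nth F n = (deriv ^^ n) f 0 / fact n"
  using assms
proof (induction n arbitrary: f F)
  case 0
  then have "eval_fps F 0 = f 0"
    using eventually_nhds_x_imp_x by (fastforce simp: has_fps_expansion_def)
  then show ?case
    by (simp add: eval_fps_at_0)
next
  case (Suc n)
  have "real (Suc n) * fps_nth F (Suc n) = fps_nth (fps_deriv F) n"
    by simp
  also have "\<dots> = (deriv ^^ n) (deriv f) 0 / fact n"
    using Suc.prems by (intro Suc.IH has_fps_expansion_deriv)
  finally show ?case
    by (simp add: field_simps funpow_Suc_right del: funpow.simps of_nat_Suc)
qed

text \<open>The coefficients are the Taylor coefficients of the sum, which depend on its germ only.\<close>

lemma power_series_from_2_unique: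
  assumes "power_series_from_2 g R" and "power_series_from_2 h S"
    and "\<forall>\<^sub>F u in nhds 0. R u = S u" and "k \<ge> 2"
  shows "g k = h k"
proof -
  have taylor: "f k = (deriv ^^ k) T 0 / fact k" if "power_series_from_2 f T" for f T
  proof -
    define F where "F = Abs_fps (\<lambda>n. if n < 2 then 0 else f n)"
    have "\<forall>\<^sub>F u in nhds 0. (\<lambda>n. fps_nth F n * u ^ n) sums T u"
      using that unfolding power_series_from_2_def
    proof eventually_elim
      case (elim u)
      then have "(\<lambda>n. fps_nth F (n + 2) * u ^ (n + 2)) sums T u"
        by (simp add: F_def)
      then show ?case
        by (subst (asm) sums_zero_iff_shift) (auto simp: F_def)
    qed
    then have "T has_fps_expansion F"
      by (rule has_fps_expansionI)
    then have "fps_nth F k = (deriv ^^ k) T 0 / fact k"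
      by (rule fps_nth_eq_higher_deriv)
    with \<open>k \<ge> 2\<close> show ?thesis
      by (simp add: F_def)
  qed
  have "(deriv ^^ k) R 0 = (deriv ^^ k) S 0"
    using assms(3) by (intro higher_deriv_cong_ev) auto
  then show ?thesis
    using taylor[OF assms(1)] taylor[OF assms(2)] by simp
qed

lemma higher_coeffs_zero_iff:
  assumes g: "power_series_from_2 g R"
  shows "(\<forall>k\<ge>3. g k = 0) \<longleftrightarrow> (\<forall>\<^sub>F u in nhds 0. R u = g 2 * u\<^sup>2)"
proof
  assume zero: "\<forall>k\<ge>3. g k = 0"
  show "\<forall>\<^sub>F u in nhds 0. R u = g 2 * u\<^sup>2"
    using g unfolding power_series_from_2_def
  proof eventually_elim
    case (elim u)
    have "(\<lambda>k. g (k + 2) * u ^ (k + 2)) sums (\<Sum>k\<in>{0}. g (k + 2) * u ^ (k + 2))"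
      using zero by (intro sums_finite) auto
    then have "(\<lambda>k. g (k + 2) * u ^ (k + 2)) sums (g 2 * u\<^sup>2)"
      by (simp add: numeral_2_eq_2)
    with elim show ?case
      by (rule sums_unique2)
  qed
next
  assume R: "\<forall>\<^sub>F u in nhds 0. R u = g 2 * u\<^sup>2"
  let ?h = "\<lambda>k. if k = 2 then g 2 else 0"
  have "(\<lambda>k. ?h (k + 2) * u ^ (k + 2)) sums (g 2 * u\<^sup>2)" for u
    using sums_finite[of "{0}" "\<lambda>k. ?h (k + 2) * u ^ (k + 2)"] by (simp add: power2_eq_square)
  then have h: "power_series_from_2 ?h (\<lambda>u. g 2 * u\<^sup>2)"
    by (simp add: power_series_from_2_def)
  show "\<forall>k\<ge>3. g k = 0"
    using power_series_from_2_unique[OF g h R] by auto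
qed

text \<open>
  With \<open>\<Sigma> = a e + b d\<close>, the cubic and higher terms come from
  \<open>\<Sigma> u / (d (d - e u)) = \<Sigma> / d\<^sup>2 u / (1 - (e / d) u)\<close>, expanded geometrically where
  \<open>\<bar>(e / d) u\<bar> < 1\<close>. There the denominator \<open>d - e u\<close> is nonzero as well.
\<close>

lemma power_series_from_2_rational:
  fixes C a b d e :: real
  assumes "d \<noteq> 0"
    and R: "\<forall>\<^sub>F u in nhds 0. R u = C * u\<^sup>2 * ((a + b * u) / (d - e * u))"
  shows "power_series_from_2
    (\<lambda>k. if k = 2 then C * a / d else C * (a * e + b * d) / d\<^sup>2 * (e / d) ^ (k - 3)) R"
    (is "power_series_from_2 ?g R")
proof -
  have "((\<lambda>u. \<bar>e / d * u\<bar>) \<longlongrightarrow> \<bar>e / d * 0\<bar>) (nhds 0)"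
    by (intro tendsto_intros filterlim_ident)
  then have "\<forall>\<^sub>F u in nhds 0. \<bar>e / d * u\<bar> < 1"
    by (rule order_tendstoD) simp
  with R show ?thesis
    unfolding power_series_from_2_def
  proof eventually_elim
    case (elim u)
    let ?c = "C * (a * e + b * d) / d\<^sup>2 * u ^ 3"
    have nz: "d - e * u \<noteq> 0"
    proof
      assume "d - e * u = 0"
      with \<open>d \<noteq> 0\<close> have "e / d * u = 1"
        by (simp add: divide_eq_eq)
      with elim(2) show False
        by (simp del: times_divide_eq_left)
    qed
    have "(\<lambda>k. (e / d * u) ^ k) sums (1 / (1 - e / d * u))"
      using elim(2) by (intro geometric_sums) simp
    then have "(\<lambda>k. ?c * (e / d * u) ^ k) sums (?c * (1 / (1 - e / d * u)))"
      by (rule sums_mult)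
    also have "(\<lambda>k. ?c * (e / d * u) ^ k) = (\<lambda>k. ?g (Suc k + 2) * u ^ (Suc k + 2))"
      by (simp add: fun_eq_iff power_mult_distrib power_divide power3_eq_cube power2_eq_square)
    finally have "(\<lambda>k. ?g (k + 2) * u ^ (k + 2)) sums
        (?c * (1 / (1 - e / d * u)) + ?g (0 + 2) * u ^ (0 + 2))"
      by (subst (asm) sums_Suc_iff) simp
    also have "?c * (1 / (1 - e / d * u)) + ?g (0 + 2) * u ^ (0 + 2) = R u"
    proof -
      have "1 - e / d * u = (d - e * u) / d"
        using \<open>d \<noteq> 0\<close> by (simp add: field_simps)
      then show ?thesis
        using \<open>d \<noteq> 0\<close> nz unfolding elim(1)
        by (simp add: divide_simps) (simp add: power2_eq_square power3_eq_cube algebra_simps)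
    qed
    finally show ?case .
  qed
qed

theorem corollary4p4:
  fixes X :: "real^2 \<Rightarrow> real^2" and A :: "real^2^2" and q :: "real^2"
    and U :: "(real^2) set" and r :: nat
    and C a b d e \<Sigma> :: real and R :: "real \<Rightarrow> real"
  assumes "open U" and "0 \<in> U" and "r \<ge> 2" and "C_class_on r X U"
    and "X 0 = 0"
    and "A = jacobian X (at 0)" and "A \<noteq> 0" and "A ** A = 0"
    and "q \<noteq> 0" and "{v. A *v v = 0} = span {q}"
    and "R = distinguished_restriction X q"
    and "\<forall>\<^sub>F u in nhds 0. R u = C * u^2 * ((a + b * u) / (d - e * u))"
    and "C * d \<noteq> 0"
    and "\<Sigma> = a * e + b * d"
  shows "(\<exists>g. power_series_from_2 g R) \<and>
    (\<forall>g. power_series_from_2 g R \<longrightarrow>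
      (\<Sigma> = 0 \<longleftrightarrow> (\<forall>k\<ge>3. g k = 0)) \<and>
      ((\<forall>k\<ge>3. g k = 0) \<longleftrightarrow> (\<forall>\<^sub>F u in nhds 0. R u = C * a / d * u^2)))"
proof -
  let ?h = "\<lambda>k. if k = 2 then C * a / d else C * \<Sigma> / d\<^sup>2 * (e / d) ^ (k - 3)"
  from \<open>C * d \<noteq> 0\<close> have "C \<noteq> 0" and "d \<noteq> 0"
    by auto
  have h: "power_series_from_2 ?h R"
    unfolding assms(14) using \<open>d \<noteq> 0\<close> assms(12) by (rule power_series_from_2_rational)
  have "(\<Sigma> = 0 \<longleftrightarrow> (\<forall>k\<ge>3. g k = 0)) \<and>
      ((\<forall>k\<ge>3. g k = 0) \<longleftrightarrow> (\<forall>\<^sub>F u in nhds 0. R u = C * a / d * u^2))"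
    if g: "power_series_from_2 g R" for g
  proof
    have coeff: "g k = ?h k" if "k \<ge> 2" for k
      using power_series_from_2_unique[OF g h _ that] by simp
    show "\<Sigma> = 0 \<longleftrightarrow> (\<forall>k\<ge>3. g k = 0)"
    proof
      assume "\<Sigma> = 0"
      then show "\<forall>k\<ge>3. g k = 0"
        using coeff by simp
    next
      assume "\<forall>k\<ge>3. g k = 0"
      \<comment> \<open>Only the cubic coefficient forces \<open>\<Sigma> = 0\<close>: the later ones also vanish when \<open>e = 0\<close>.\<close>
      then have "C * \<Sigma> / d\<^sup>2 = 0"
        using coeff[of 3] by simp
      with \<open>C \<noteq> 0\<close> \<open>d \<noteq> 0\<close> show "\<Sigma> = 0"
        by simp
    qed
    have "g 2 = C * a / d"
      using coeff[of 2] by simp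
    then show "(\<forall>k\<ge>3. g k = 0) \<longleftrightarrow> (\<forall>\<^sub>F u in nhds 0. R u = C * a / d * u^2)"
      using higher_coeffs_zero_iff[OF g] by simp
  qed
  with h show ?thesis
    by blast
qed

end
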